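(* Fix positive integers $i, j$. For each integer $d \geq \max(i,j)$, let $u_{ij}$ denote the $(i,j)$ entry of a matrix $U$ chosen randomly with respect to normalized Haar measure from the unitary group $U(d)$. Then, as $d \rightarrow \infty$, the random variable $\sqrt{d}\, u_{ij}$ converges in distribution to a standard complex Gaussian random variable.
   Context: $U(d)$ is the group of $d \times d$ complex unitary matrices, regarded as a probability space under normalized Haar measure. A standard complex Gaussian random variable is $z = x + \sqrt{-1}\, y$, where $x, y$ are independent real Gaussian random variables each with mean $0$ and variance $1/2$. *)

theory Defs
  imports "HOL-Probability.Probability" "Jordan_Normal_Form.Schur_Decomposition"
begin

definition unitary_group :: "nat \<Rightarrow> complex mat set" where
  "unitary_group d =
     {U \<in> carrier_mat d d. U * mat_adjoint U = 1\<^sub>m d \<and> mat_adjoint U * U = 1\<^sub>m d}"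

(* The library type of matrices carries no topology.  The Borel sets of U(d), as a subspace of
   C^(d x d), are the traces of the product sigma-algebra on the d x d matrix entries. *)
definition unitary_borel :: "nat \<Rightarrow> complex mat measure" where
  "unitary_borel d =
     vimage_algebra (unitary_group d)
       (\<lambda>U. \<lambda>p\<in>{..<d} \<times> {..<d}. U $$ p)
       (\<Pi>\<^sub>M p\<in>{..<d} \<times> {..<d}. (borel :: complex measure))"

(* Left translation invariance and total mass 1 determine Haar measure on a compact group. *)
definition haar_prob_measure :: "nat \<Rightarrow> complex mat measure \<Rightarrow> bool" where
  "haar_prob_measure d \<mu> \<longleftrightarrow>
     sets \<mu> = sets (unitary_borel d) \<and> prob_space \<mu> \<and>
     (\<forall>V\<in>unitary_group d. \<forall>A\<in>sets \<mu>. emeasure \<mu> ((\<lambda>U. V * U) ` A) = emeasure \<mu> A)"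

(* normal_density takes the standard deviation, so sqrt (1/2) gives variance 1/2. *)
definition std_complex_gaussian :: "'a measure \<Rightarrow> ('a \<Rightarrow> complex) \<Rightarrow> bool" where
  "std_complex_gaussian M z \<longleftrightarrow>
     prob_space M \<and>
     distributed M lborel (\<lambda>\<omega>. Re (z \<omega>)) (normal_density 0 (sqrt (1/2))) \<and>
     distributed M lborel (\<lambda>\<omega>. Im (z \<omega>)) (normal_density 0 (sqrt (1/2))) \<and>
     prob_space.indep_var M borel (\<lambda>\<omega>. Re (z \<omega>)) borel (\<lambda>\<omega>. Im (z \<omega>))"

(* The library's weak_conv_m is stated through distribution functions and only covers measures on
   the real line; this is weak convergence tested on bounded continuous functions. *)
definition weak_conv_bdd_cont :: "(nat \<Rightarrow> 'a::topological_space measure) \<Rightarrow> 'a measure \<Rightarrow> bool" where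
  "weak_conv_bdd_cont N_seq N \<longleftrightarrow>
     (\<forall>f :: 'a \<Rightarrow> real. continuous_on UNIV f \<and> bounded (range f) \<longrightarrow>
        (\<lambda>n. \<integral>x. f x \<partial>N_seq n) \<longlonglongrightarrow> (\<integral>x. f x \<partial>N))"

end

theory Submission
  imports Defs "HOL-Real_Asymp.Real_Asymp"
begin

text \<open>
  Let \<open>u\<close> be a column of a Haar unitary and \<open>X = Re u\<^sub>a\<close>. Left translation by a rotation of two
  coordinates or by a phase shows that \<open>E (\<alpha> X + \<beta> Y)\<^sup>2\<^sup>n\<close> does not depend on \<open>(\<alpha>, \<beta>)\<close> on the unit circle,
  for each of the other \<open>2 d - 1\<close> real coordinates \<open>Y\<close> of \<open>u\<close>. Hence
  \<open>E (X + t Y)\<^sup>2\<^sup>n = (1 + t\<^sup>2)\<^sup>n E X\<^sup>2\<^sup>n\<close>, and comparing the coefficients of \<open>t\<^sup>2\<close> and summing over \<open>Y\<close>,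
  where all the squares add up to 1, gives a recursion for the moments of \<open>X\<close>. By Tannery's theorem
  \<open>E cos (r \<surd>d X)\<close> tends to \<open>exp (- r\<^sup>2 / 4)\<close>; by invariance under a phase this is convergence of the
  characteristic functions on the plane.

  To pass to bounded continuous \<open>f\<close>, use tightness to replace \<open>f\<close> by the doubly periodic function that agrees
  with it on a large square and has the form \<open>g (sin (c x), sin (c y))\<close>. The Weierstrass theorem approximates
  \<open>g\<close> by polynomials, so that this function is a uniform limit of trigonometric polynomials on the whole plane.
\<close>

subsection \<open>Weak convergence on the complex plane\<close>

text \<open>The phase \<open>\<delta>\<close> makes one constructor cover cosines, sines and
  constants, and keeps the class closed under products.\<close>

inductive trig_poly :: "(complex \<Rightarrow> real) \<Rightarrow> bool" where
  cos: "trig_poly (\<lambda>z. a * cos (inner \<zeta> z + \<delta>))"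
| add: "trig_poly f \<Longrightarrow> trig_poly g \<Longrightarrow> trig_poly (\<lambda>z. f z + g z)"

text \<open>Product-to-sum formula: the frequencies \<open>\<zeta>\<close> and \<open>\<xi>\<close>
  combine to \<open>\<zeta> - \<xi>\<close> and \<open>\<zeta> + \<xi>\<close>, and the phases
  likewise.\<close>

lemma trig_poly_mult_cos:
  assumes "trig_poly g"
  shows "trig_poly (\<lambda>z. a * cos (inner \<zeta> z + \<delta>) * g z)"
  using assms
proof induction
  case (cos b \<xi> \<epsilon>)
  have "(\<lambda>z. a * cos (inner \<zeta> z + \<delta>) * (b * cos (inner \<xi> z + \<epsilon>))) =
    (\<lambda>z. (a * b / 2) * cos (inner (\<zeta> - \<xi>) z + (\<delta> - \<epsilon>)) + (a * b / 2) * cos (inner (\<zeta> + \<xi>) z + (\<delta> + \<epsilon>)))"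
  proof
    fix z
    have eqs: "inner (\<zeta> - \<xi>) z + (\<delta> - \<epsilon>) = (inner \<zeta> z + \<delta>) - (inner \<xi> z + \<epsilon>)"
      "inner (\<zeta> + \<xi>) z + (\<delta> + \<epsilon>) = (inner \<zeta> z + \<delta>) + (inner \<xi> z + \<epsilon>)"
      by (simp_all add: algebra_simps)
    show "a * cos (inner \<zeta> z + \<delta>) * (b * cos (inner \<xi> z + \<epsilon>)) =
      (a * b / 2) * cos (inner (\<zeta> - \<xi>) z + (\<delta> - \<epsilon>)) + (a * b / 2) * cos (inner (\<zeta> + \<xi>) z + (\<delta> + \<epsilon>))"
      unfolding eqs cos_add cos_diff by (simp add: field_simps)
  qed
  then show ?case
    by (simp only: trig_poly.add[OF trig_poly.cos trig_poly.cos])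
next
  case (add f g)
  then show ?case
    by (auto simp: distrib_left intro: trig_poly.add)
qed

lemma trig_poly_mult:
  assumes "trig_poly f" "trig_poly g"
  shows "trig_poly (\<lambda>z. f z * g z)"
  using assms(1)
proof induction
  case (cos a \<zeta> \<delta>)
  then show ?case using trig_poly_mult_cos[OF assms(2)] .
next
  case (add f f')
  then show ?case
    by (auto simp: distrib_right intro: trig_poly.add)
qed

lemma trig_poly_const: "trig_poly (\<lambda>z. a)"
  using trig_poly.cos[of a 0 0] by simp

lemma trig_poly_sin: "trig_poly (\<lambda>z. a * sin (inner \<zeta> z))"
  using trig_poly.cos[of a \<zeta> "-pi/2"] by (simp add: cos_diff)

text \<open>Trigonometric polynomials form an algebra, so only the linear case calls for a
  computation.\<close>

lemma trig_poly_polynomial_sin: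
  fixes p :: "real \<times> real \<Rightarrow> real"
  assumes "real_polynomial_function p"
  shows "trig_poly (\<lambda>z. p (sin (c * Re z), sin (c * Im z)))"
  using assms
proof induction
  case (linear f)
  interpret bounded_linear f by fact
  have lin: "f (x, y) = f (1, 0) * x + f (0, 1) * y" for x y
  proof -
    have "f (x, y) = f (x *\<^sub>R (1, 0) + y *\<^sub>R (0, 1))" by simp
    then show ?thesis unfolding add scaleR by simp
  qed
  \<comment> \<open>The frequency \<open>of_real c\<close> picks out \<open>c * Re z\<close>, and
    \<open>of_real c * \<i>\<close> picks out \<open>c * Im z\<close>.\<close>
  have "(\<lambda>z. f (sin (c * Re z), sin (c * Im z))) =
    (\<lambda>z. f (1, 0) * sin (inner (of_real c) z) + f (0, 1) * sin (inner (of_real c * \<i>) z))"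
    by (intro ext, subst lin) (simp add: inner_complex_def)
  moreover have "trig_poly (\<lambda>z. f (1, 0) * sin (inner (of_real c) z) + f (0, 1) * sin (inner (of_real c * \<i>) z))"
    by (intro trig_poly.add trig_poly_sin)
  ultimately show ?case
    by simp
next
  case (const c)
  show ?case by (rule trig_poly_const)
next
  case (add f g)
  then show ?case by (intro trig_poly.add)
next
  case (mult f g)
  then show ?case by (intro trig_poly_mult)
qed

lemma trig_poly_integrable:
  assumes "finite_measure M" and "trig_poly f" and [simp, measurable_cong]: "sets M = sets borel"
  shows "integrable M f"
  using assms(2)
proof induction
  case (cos a \<zeta> \<delta>)
  show ?case
    by (rule finite_measure.integrable_const_bound[OF assms(1), where B = "\<bar>a\<bar>"]) (auto simp: abs_mult intro!: mult_left_le)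
qed auto

text \<open>The addition formula moves the phase into the coefficients, which leaves the pure cosine
  and sine integrals of the hypotheses.\<close>

lemma trig_poly_integral_tendsto:
  fixes P :: "nat \<Rightarrow> complex measure"
  assumes "\<And>n. prob_space (P n)" "prob_space Q"
    and sets: "\<And>n. sets (P n) = sets borel" "sets Q = sets borel"
    and cos: "\<And>\<zeta>. (\<lambda>n. \<integral>z. cos (inner \<zeta> z) \<partial>P n) \<longlonglongrightarrow> (\<integral>z. cos (inner \<zeta> z) \<partial>Q)"
    and sin: "\<And>\<zeta>. (\<lambda>n. \<integral>z. sin (inner \<zeta> z) \<partial>P n) \<longlonglongrightarrow> (\<integral>z. sin (inner \<zeta> z) \<partial>Q)"
    and "trig_poly f"
  shows "(\<lambda>n. \<integral>z. f z \<partial>P n) \<longlonglongrightarrow> (\<integral>z. f z \<partial>Q)"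
  using \<open>trig_poly f\<close>
proof induction
  case (cos a \<zeta> \<delta>)
  have *: "(\<integral>z. a * cos (inner \<zeta> z + \<delta>) \<partial>N) =
      (a * cos \<delta>) * (\<integral>z. cos (inner \<zeta> z) \<partial>N) - (a * sin \<delta>) * (\<integral>z. sin (inner \<zeta> z) \<partial>N)"
    if "prob_space N" "sets N = sets borel" for N
  proof -
    interpret prob_space N by fact
    have i: "integrable N (\<lambda>z. cos (inner \<zeta> z))" "integrable N (\<lambda>z. sin (inner \<zeta> z))"
      using trig_poly_integrable[OF finite_measure_axioms trig_poly.cos[of 1 \<zeta> 0] that(2)]
        trig_poly_integrable[OF finite_measure_axioms trig_poly_sin[of 1 \<zeta>] that(2)] by simp_all
    have "(\<integral>z. a * cos (inner \<zeta> z + \<delta>) \<partial>N) =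
        (\<integral>z. (a * cos \<delta>) * cos (inner \<zeta> z) - (a * sin \<delta>) * sin (inner \<zeta> z) \<partial>N)"
      by (simp add: cos_add algebra_simps)
    also have "\<dots> = (a * cos \<delta>) * (\<integral>z. cos (inner \<zeta> z) \<partial>N) - (a * sin \<delta>) * (\<integral>z. sin (inner \<zeta> z) \<partial>N)"
      using i by (subst Bochner_Integration.integral_diff) auto
    finally show ?thesis .
  qed
  show ?case
    unfolding *[OF assms(1) sets(1)] *[OF assms(2) sets(2)]
    by (intro tendsto_intros assms)
next
  case (add f g)
  have *: "(\<integral>z. f z + g z \<partial>N) = (\<integral>z. f z \<partial>N) + (\<integral>z. g z \<partial>N)"
    if "prob_space N" "sets N = sets borel" for N
  proof -
    interpret prob_space N by fact
    show ?thesis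
      using add.hyps that by (intro Bochner_Integration.integral_add trig_poly_integrable finite_measure_axioms)
  qed
  show ?case
    unfolding *[OF assms(1) sets(1)] *[OF assms(2) sets(2)]
    by (intro tendsto_intros add.IH)
qed

text \<open>Continuity from above: the tails decrease to the empty set.\<close>

lemma tail_measure_small:
  fixes M :: "'a :: real_normed_vector measure" and e :: real
  assumes "finite_measure M" and [simp, measurable_cong]: "sets M = sets borel" and "e > 0"
  shows "\<exists>R. measure M {z. R \<le> norm z} \<le> e"
proof -
  interpret finite_measure M by fact
  have "(\<lambda>n. measure M {z. real n \<le> norm z}) \<longlonglongrightarrow> measure M (\<Inter>n. {z. real n \<le> norm z})"
    by (rule finite_Lim_measure_decseq) (auto simp: decseq_def)
  also have "(\<Inter>n. {z :: 'a. real n \<le> norm z}) = {}"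
    by (simp add: set_eq_iff not_le reals_Archimedean2)
  finally have "eventually (\<lambda>n. measure M {z. real n \<le> norm z} < e) sequentially"
    using \<open>e > 0\<close> by (intro order_tendstoD) auto
  then show ?thesis
    using eventually_happens[of _ sequentially] by (force intro: less_imp_le)
qed

text \<open>A form of Levy's continuity theorem in the plane, with tightness as a hypothesis and the
  characteristic functions split into real and imaginary parts.\<close>

theorem weak_conv_complexI:
  fixes P :: "nat \<Rightarrow> complex measure"
  assumes prob: "\<And>n. prob_space (P n)" "prob_space Q"
    and sets: "\<And>n. sets (P n) = sets borel" "sets Q = sets borel"
    and tight: "\<And>e. e > 0 \<Longrightarrow> \<exists>R. \<forall>n. measure (P n) {z. R \<le> norm z} \<le> e"
    and cos: "\<And>\<zeta>. (\<lambda>n. \<integral>z. cos (inner \<zeta> z) \<partial>P n) \<longlonglongrightarrow> (\<integral>z. cos (inner \<zeta> z) \<partial>Q)"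
    and sin: "\<And>\<zeta>. (\<lambda>n. \<integral>z. sin (inner \<zeta> z) \<partial>P n) \<longlonglongrightarrow> (\<integral>z. sin (inner \<zeta> z) \<partial>Q)"
  shows "weak_conv_bdd_cont P Q"
  unfolding weak_conv_bdd_cont_def
proof (intro allI impI, elim conjE)
  fix f :: "complex \<Rightarrow> real"
  assume f: "continuous_on UNIV f" and "bounded (range f)"
  then obtain B where B: "B > 0" "\<And>z. \<bar>f z\<bar> \<le> B"
    unfolding bounded_pos by auto
  show "(\<lambda>n. \<integral>z. f z \<partial>P n) \<longlonglongrightarrow> (\<integral>z. f z \<partial>Q)"
  proof (rule LIMSEQ_I)
    fix \<epsilon> :: real assume "\<epsilon> > 0"
    \<comment> \<open>Replacing \<open>f\<close> by \<open>T\<close> costs at most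
      \<open>e + 2 * B * e\<close> under each of the two measures, and comparing the integrals of
      \<open>T\<close> costs less than \<open>e\<close>; the total stays below
      \<open>(4 + 4 * B) * e\<close>.\<close>
    define e where "e = \<epsilon> / (4 + 4 * B)"
    have e: "e > 0" "(4 + 4 * B) * e = \<epsilon>"
      using \<open>\<epsilon> > 0\<close> B(1) by (auto simp: e_def add_pos_pos)
    interpret Q: prob_space Q by fact
    obtain R1 where R1: "\<And>n. measure (P n) {z. R1 \<le> norm z} \<le> e"
      using tight[OF e(1)] by auto
    obtain R2 where R2: "measure Q {z. R2 \<le> norm z} \<le> e"
      using tail_measure_small[OF Q.finite_measure_axioms sets(2) e(1)] by auto
    define R where "R = max 1 (max R1 R2)"
    have R: "R > 0" "R1 \<le> R" "R2 \<le> R" by (auto simp: R_def)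
    \<comment> \<open>With this scale, \<open>\<bar>x\<bar> < R\<close> puts \<open>c * x\<close> in
      the range where \<open>arcsin\<close> inverts \<open>sin\<close>.\<close>
    define c where "c = pi / (2 * R)"
    have c: "c > 0" using R by (simp add: c_def)
    define g where "g p = f (Complex (arcsin (fst p) / c) (arcsin (snd p) / c))" for p
    have "continuous_on ({-1..1} \<times> {-1..1}) g"
      unfolding g_def
      by (rule continuous_on_compose2[OF f])
        (use c in \<open>auto intro!: continuous_intros simp: Complex_eq\<close>)
    from Stone_Weierstrass_real_polynomial_function[OF _ this e(1)]
    obtain p where p: "real_polynomial_function p"
      "\<And>x. x \<in> {-1..1} \<times> {-1..1} \<Longrightarrow> \<bar>g x - p x\<bar> < e"
      by (auto intro: compact_Times)
    define T where "T z = p (sin (c * Re z), sin (c * Im z))" for z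
    have T: "trig_poly T"
      unfolding T_def by (rule trig_poly_polynomial_sin[OF p(1)])
    have g_T: "\<bar>g (sin (c * Re z), sin (c * Im z)) - T z\<bar> < e" for z
      unfolding T_def by (rule p(2)) auto
    have f_g: "g (sin (c * Re z), sin (c * Im z)) = f z" if "norm z < R" for z
    proof -
      have "\<bar>c * x\<bar> \<le> pi / 2" if "\<bar>x\<bar> < R" for x
        using that R(1) by (simp add: c_def abs_mult field_simps)
      from this[of "Re z"] this[of "Im z"] that abs_Re_le_cmod[of z] abs_Im_le_cmod[of z]
      have "arcsin (sin (c * Re z)) = c * Re z" "arcsin (sin (c * Im z)) = c * Im z"
        by (auto intro!: arcsin_sin simp: abs_le_iff)
      then show ?thesis using c by (simp add: g_def)
    qed
    \<comment> \<open>Inside the disc only the Weierstrass error remains. Outside it,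
      \<open>f\<close> and the periodic function are each bounded by \<open>B\<close>, since every
      value of \<open>g\<close> is a value of \<open>f\<close>.\<close>
    have bound: "\<bar>f z - T z\<bar> \<le> e + 2 * B * indicator {z. R \<le> norm z} z" for z
    proof (cases "norm z < R")
      case True
      then show ?thesis using g_T[of z] f_g[of z] by simp
    next
      case False
      have "\<bar>g (sin (c * Re z), sin (c * Im z))\<bar> \<le> B" unfolding g_def by (rule B)
      then show ?thesis using g_T[of z] B(2)[of z] False by simp
    qed
    have est: "\<bar>(\<integral>z. f z \<partial>N) - (\<integral>z. T z \<partial>N)\<bar> \<le> e + 2 * B * e"
      if "prob_space N" and [simp, measurable_cong]: "sets N = sets borel"
        and "measure N {z. R \<le> norm z} \<le> e" for N
    proof -
      interpret prob_space N by fact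
      have fm [measurable]: "f \<in> borel_measurable borel"
        using f by (rule borel_measurable_continuous_onI)
      have fi: "integrable N f"
        by (rule integrable_const_bound[where B = B]) (use B in auto)
      have Ti: "integrable N T"
        by (rule trig_poly_integrable[OF finite_measure_axioms T]) simp
      have "\<bar>(\<integral>z. f z \<partial>N) - (\<integral>z. T z \<partial>N)\<bar> = \<bar>\<integral>z. f z - T z \<partial>N\<bar>"
        using fi Ti by simp
      also have "\<dots> \<le> (\<integral>z. \<bar>f z - T z\<bar> \<partial>N)"
        by (rule integral_abs_bound)
      also have "\<dots> \<le> (\<integral>z. e + 2 * B * indicator {z. R \<le> norm z} z \<partial>N)"
        using fi Ti by (intro integral_mono bound) (auto intro!: integrable_real_indicator simp: emeasure_eq_measure)
      also have "\<dots> = e + 2 * B * measure N {z. R \<le> norm z}"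
        by (subst Bochner_Integration.integral_add)
          (use prob_space sets_eq_imp_space_eq[OF that(2)] in \<open>auto intro!: integrable_real_indicator simp: emeasure_eq_measure\<close>)
      also have "\<dots> \<le> e + 2 * B * e"
        using that(3) B by simp
      finally show ?thesis .
    qed
    \<comment> \<open>Tails shrink as the radius grows, so the single radius \<open>R\<close> serves
      for every \<open>P n\<close> and for \<open>Q\<close>.\<close>
    have mono: "measure N {z. R \<le> norm z} \<le> e"
      if "prob_space N" and [simp, measurable_cong]: "sets N = sets borel" and "measure N {z. S \<le> norm z} \<le> e" "S \<le> R" for N S
    proof -
      interpret prob_space N by fact
      have "measure N {z. R \<le> norm z} \<le> measure N {z. S \<le> norm z}"
        using that(4) by (intro finite_measure_mono) auto
      then show ?thesis using that(3) by simp
    qed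
    have "(\<lambda>n. \<integral>z. T z \<partial>P n) \<longlonglongrightarrow> (\<integral>z. T z \<partial>Q)"
      by (rule trig_poly_integral_tendsto[OF prob sets cos sin T])
    from LIMSEQ_D[OF this e(1)] obtain n0 where n0:
      "\<And>n. n \<ge> n0 \<Longrightarrow> \<bar>(\<integral>z. T z \<partial>P n) - (\<integral>z. T z \<partial>Q)\<bar> < e"
      by auto
    show "\<exists>n0. \<forall>n\<ge>n0. norm ((\<integral>z. f z \<partial>P n) - (\<integral>z. f z \<partial>Q)) < \<epsilon>"
    proof (intro exI allI impI)
      fix n assume "n \<ge> n0"
      have "\<bar>(\<integral>z. f z \<partial>P n) - (\<integral>z. T z \<partial>P n)\<bar> \<le> e + 2 * B * e"
        by (intro est prob sets mono[OF prob(1) sets(1) R1 R(2)])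
      moreover have "\<bar>(\<integral>z. f z \<partial>Q) - (\<integral>z. T z \<partial>Q)\<bar> \<le> e + 2 * B * e"
        by (intro est prob sets mono[OF prob(2) sets(2) R2 R(3)])
      moreover have "\<epsilon> = 4 * e + 4 * B * e"
        using e by (simp add: algebra_simps)
      ultimately show "norm ((\<integral>z. f z \<partial>P n) - (\<integral>z. f z \<partial>Q)) < \<epsilon>"
        using n0[OF \<open>n \<ge> n0\<close>] e(1) by simp
    qed
  qed
qed

subsection \<open>Unitary matrices and Haar measure\<close>

lemma mat_adjoint_index:
  fixes A :: "complex mat"
  assumes "p < dim_col A" "q < dim_row A"
  shows "mat_adjoint A $$ (p, q) = cnj (A $$ (q, p))"
  using assms by (simp add: mat_adjoint_def mat_of_rows_def)

lemma mat_adjoint_carrier: "A \<in> carrier_mat n m \<Longrightarrow> mat_adjoint A \<in> carrier_mat m n"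
  for A :: "complex mat"
  by (auto simp: mat_adjoint_def)

lemma mat_adjoint_adjoint: "mat_adjoint (mat_adjoint A) = A" for A :: "complex mat"
proof -
  have "mat_adjoint A \<in> carrier_mat (dim_col A) (dim_row A)"
    using mat_adjoint_carrier[of A "dim_row A" "dim_col A"] by auto
  moreover from mat_adjoint_carrier[OF this]
  have "mat_adjoint (mat_adjoint A) \<in> carrier_mat (dim_row A) (dim_col A)" .
  ultimately show ?thesis
    by (intro eq_matI) (auto simp: mat_adjoint_index)
qed

lemma mat_times_index_sum:
  assumes "A \<in> carrier_mat n d" "B \<in> carrier_mat d m" "p < n" "q < m"
  shows "(A * B) $$ (p, q) = (\<Sum>k<d. A $$ (p, k) * B $$ (k, q))"
  using assms by (auto simp: scalar_prod_def lessThan_atLeast0 intro!: sum.cong)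

text \<open>Orthonormal rows make the adjoint a right inverse; for square matrices a right inverse
  is also a left inverse.\<close>

lemma unitary_groupI:
  assumes V: "V \<in> carrier_mat d d"
    and rows: "\<And>p q. p < d \<Longrightarrow> q < d \<Longrightarrow> (\<Sum>k<d. V $$ (p, k) * cnj (V $$ (q, k))) = (if p = q then 1 else 0)"
  shows "V \<in> unitary_group d"
proof -
  have V': "mat_adjoint V \<in> carrier_mat d d"
    using V by (rule mat_adjoint_carrier)
  have "V * mat_adjoint V = 1\<^sub>m d"
  proof (rule eq_matI)
    fix p q assume "p < dim_row (1\<^sub>m d :: complex mat)" "q < dim_col (1\<^sub>m d :: complex mat)"
    then have pq: "p < d" "q < d" by auto
    have "(V * mat_adjoint V) $$ (p, q) = (\<Sum>k<d. V $$ (p, k) * mat_adjoint V $$ (k, q))"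
      by (rule mat_times_index_sum[OF V V' pq])
    also have "\<dots> = (\<Sum>k<d. V $$ (p, k) * cnj (V $$ (q, k)))"
      using V pq by (intro sum.cong) (auto simp: mat_adjoint_index)
    finally show "(V * mat_adjoint V) $$ (p, q) = 1\<^sub>m d $$ (p, q)"
      using rows[OF pq] pq by simp
  qed (use V V' in auto)
  with mat_mult_left_right_inverse[OF V V' this] V show ?thesis
    by (simp add: unitary_group_def)
qed

lemma unitary_group_adjoint: "V \<in> unitary_group d \<Longrightarrow> mat_adjoint V \<in> unitary_group d"
  by (auto simp: unitary_group_def mat_adjoint_adjoint mat_adjoint_carrier)

lemma unitary_group_mult:
  assumes "V \<in> unitary_group d" "U \<in> unitary_group d"
  shows "V * U \<in> unitary_group d"
proof (rule unitary_groupI)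
  have V: "V \<in> carrier_mat d d" and U: "U \<in> carrier_mat d d"
    and U1: "U * mat_adjoint U = 1\<^sub>m d" and V1: "V * mat_adjoint V = 1\<^sub>m d"
    using assms by (auto simp: unitary_group_def)
  note U' = mat_adjoint_carrier[OF U] and V' = mat_adjoint_carrier[OF V]
  show VU: "V * U \<in> carrier_mat d d" using U V by simp
  fix p q assume pq: "p < d" "q < d"
  \<comment> \<open>The entrywise form of the rule that the adjoint of a product is the reversed
    product of the adjoints.\<close>
  have adj: "cnj ((V * U) $$ (q, k)) = (mat_adjoint U * mat_adjoint V) $$ (k, q)" if "k < d" for k
    using that pq U V
    by (subst mat_times_index_sum[OF V U], simp_all,
        subst mat_times_index_sum[OF U' V'], simp_all add: mat_adjoint_index mult.commute)
  have "(\<Sum>k<d. (V * U) $$ (p, k) * cnj ((V * U) $$ (q, k))) = (V * U * (mat_adjoint U * mat_adjoint V)) $$ (p, q)"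
    using U' V' pq by (subst mat_times_index_sum[OF VU, of _ d]) (auto simp: adj)
  also have "V * U * (mat_adjoint U * mat_adjoint V) = V * (U * mat_adjoint U) * mat_adjoint V"
    using U V U' V' by (simp add: assoc_mult_mat[of _ d d _ d _ d])
  also have "\<dots> = 1\<^sub>m d"
    using V V1 by (simp add: U1)
  finally show "(\<Sum>k<d. (V * U) $$ (p, k) * cnj ((V * U) $$ (q, k))) = (if p = q then 1 else 0)"
    using pq by simp
qed

text \<open>A diagonal entry of \<open>mat_adjoint U * U = 1\<^sub>m d\<close>. This is the identity
  that closes the moment recursion.\<close>

lemma unitary_column_norm:
  assumes "U \<in> unitary_group d" "q < d"
  shows "(\<Sum>k<d. (cmod (U $$ (k, q)))\<^sup>2) = 1"
proof -
  have U: "U \<in> carrier_mat d d" and U1: "mat_adjoint U * U = 1\<^sub>m d"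
    using assms by (auto simp: unitary_group_def)
  have "of_real (\<Sum>k<d. (cmod (U $$ (k, q)))\<^sup>2) = (\<Sum>k<d. mat_adjoint U $$ (q, k) * U $$ (k, q))"
    using U assms(2)
    by (simp add: mat_adjoint_index complex_norm_square mult.commute del: of_real_power)
  also have "\<dots> = (mat_adjoint U * U) $$ (q, q)"
    using mat_times_index_sum[OF mat_adjoint_carrier[OF U] U assms(2) assms(2)] by simp
  also have "\<dots> = of_real 1"
    using assms(2) by (simp add: U1)
  finally show ?thesis
    by (simp only: of_real_eq_iff)
qed

text \<open>A complex Givens rotation in the coordinates \<open>a\<close> and \<open>k\<close>. Row
  \<open>a\<close> sends a column \<open>u\<close> to \<open>\<alpha>\<close> times its entry
  \<open>a\<close> plus \<open>\<gamma>\<close> times its entry \<open>k\<close>; row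
  \<open>k\<close> is the completion to a unitary matrix.\<close>

definition givens :: "nat \<Rightarrow> nat \<Rightarrow> nat \<Rightarrow> real \<Rightarrow> complex \<Rightarrow> complex mat" where
  "givens d a k \<alpha> \<gamma> = mat d d (\<lambda>(p, q).
     if p = a then (if q = a then of_real \<alpha> else if q = k then \<gamma> else 0)
     else if p = k then (if q = a then - cnj \<gamma> else if q = k then of_real \<alpha> else 0)
     else if p = q then 1 else 0)"

lemma sum_supported_on_pair:
  fixes f :: "nat \<Rightarrow> 'b :: comm_monoid_add"
  assumes "a < d" "k < d" "a \<noteq> k" "\<And>q. q < d \<Longrightarrow> q \<noteq> a \<Longrightarrow> q \<noteq> k \<Longrightarrow> f q = 0"
  shows "(\<Sum>q<d. f q) = f a + f k"
proof -
  have "(\<Sum>q<d. f q) = (\<Sum>q\<in>{a, k}. f q)"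
    by (rule sum.mono_neutral_right) (use assms in auto)
  with assms(3) show ?thesis by simp
qed

text \<open>Rows \<open>a\<close> and \<open>k\<close> are supported on the two columns
  \<open>a\<close> and \<open>k\<close>, where the claim is a two by two computation; all other rows
  are standard basis vectors.\<close>

lemma givens_unitary:
  assumes "a < d" "k < d" "a \<noteq> k" "\<alpha>\<^sup>2 + (cmod \<gamma>)\<^sup>2 = 1"
  shows "givens d a k \<alpha> \<gamma> \<in> unitary_group d"
proof (rule unitary_groupI)
  let ?V = "givens d a k \<alpha> \<gamma>"
  show "?V \<in> carrier_mat d d" by (simp add: givens_def)
  have sq: "of_real \<alpha> * of_real \<alpha> + \<gamma> * cnj \<gamma> = 1"
  proof -
    have "of_real \<alpha> * of_real \<alpha> + \<gamma> * cnj \<gamma> = complex_of_real (\<alpha>\<^sup>2 + (cmod \<gamma>)\<^sup>2)"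
      by (simp add: complex_norm_square[symmetric] power2_eq_square)
    with assms(4) show ?thesis by simp
  qed
  fix p q assume pq: "p < d" "q < d"
  consider "p = a \<or> p = k" | "p \<noteq> a" "p \<noteq> k" by blast
  then show "(\<Sum>l<d. ?V $$ (p, l) * cnj (?V $$ (q, l))) = (if p = q then 1 else 0)"
  proof cases
    case 1
    then have "(\<Sum>l<d. ?V $$ (p, l) * cnj (?V $$ (q, l))) =
        ?V $$ (p, a) * cnj (?V $$ (q, a)) + ?V $$ (p, k) * cnj (?V $$ (q, k))"
      by (intro sum_supported_on_pair) (use assms pq in \<open>auto simp: givens_def\<close>)
    also have "\<dots> = (if p = q then 1 else 0)"
      using 1 assms pq sq by (auto simp: givens_def algebra_simps)
    finally show ?thesis .
  next
    case 2
    then have "(\<Sum>l<d. ?V $$ (p, l) * cnj (?V $$ (q, l))) = (\<Sum>l<d. if l = p then cnj (?V $$ (q, p)) else 0)"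
      by (intro sum.cong) (use assms pq in \<open>auto simp: givens_def\<close>)
    also have "\<dots> = (if p = q then 1 else 0)"
      using 2 assms pq by (auto simp: givens_def)
    finally show ?thesis .
  qed
qed

lemma scalar_unitary:
  assumes "cmod c = 1"
  shows "c \<cdot>\<^sub>m 1\<^sub>m d \<in> unitary_group d"
proof (rule unitary_groupI)
  show "c \<cdot>\<^sub>m 1\<^sub>m d \<in> carrier_mat d d" by simp
  fix p q assume pq: "p < d" "q < d"
  have "(\<Sum>k<d. (c \<cdot>\<^sub>m 1\<^sub>m d) $$ (p, k) * cnj ((c \<cdot>\<^sub>m 1\<^sub>m d) $$ (q, k))) =
      (\<Sum>k<d. if k = p then (if p = q then c * cnj c else 0) else 0)"
    using pq by (intro sum.cong) auto
  also have "\<dots> = (if p = q then 1 else 0)"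
    using pq assms by (simp add: complex_norm_square[symmetric])
  finally show "(\<Sum>k<d. (c \<cdot>\<^sub>m 1\<^sub>m d) $$ (p, k) * cnj ((c \<cdot>\<^sub>m 1\<^sub>m d) $$ (q, k))) = (if p = q then 1 else 0)" .
qed

section \<open>Measurability and left invariance for Haar measure\<close>

lemma haar_space:
  assumes "haar_prob_measure d \<mu>"
  shows "space \<mu> = unitary_group d"
  using sets_eq_imp_space_eq[of \<mu> "unitary_borel d"] assms
  by (simp add: haar_prob_measure_def unitary_borel_def)

lemma haar_entry_measurable:
  assumes "haar_prob_measure d \<mu>" "p < d" "q < d"
  shows "(\<lambda>U. U $$ (p, q)) \<in> borel_measurable \<mu>"
proof -
  let ?N = "\<Pi>\<^sub>M p\<in>{..<d} \<times> {..<d}. (borel :: complex measure)"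
  have "(\<lambda>U. \<lambda>p\<in>{..<d} \<times> {..<d}. U $$ p) \<in> unitary_borel d \<rightarrow>\<^sub>M ?N"
    unfolding unitary_borel_def by (rule measurable_vimage_algebra1) (auto simp: space_PiM)
  moreover have "(\<lambda>x. x (p, q)) \<in> borel_measurable ?N"
    using assms by (intro measurable_component_singleton) auto
  ultimately have "(\<lambda>U. (\<lambda>p\<in>{..<d} \<times> {..<d}. U $$ p) (p, q)) \<in> borel_measurable (unitary_borel d)"
    by (rule measurable_compose)
  then have "(\<lambda>U. U $$ (p, q)) \<in> borel_measurable (unitary_borel d)"
    using assms by simp
  also have "measurable (unitary_borel d) borel = measurable \<mu> borel"
    using assms by (intro measurable_cong_sets) (auto simp: haar_prob_measure_def)
  finally show ?thesis .
qed

text \<open>The sigma-algebra is generated by the entries, and each entry of \<open>V * U\<close> is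
  a finite linear combination of entries of \<open>U\<close>.\<close>

lemma haar_left_measurable:
  assumes haar: "haar_prob_measure d \<mu>" and V: "V \<in> unitary_group d"
  shows "(\<lambda>U. V * U) \<in> \<mu> \<rightarrow>\<^sub>M \<mu>"
proof -
  let ?N = "\<Pi>\<^sub>M p\<in>{..<d} \<times> {..<d}. (borel :: complex measure)"
  have "(\<lambda>U. V * U) \<in> \<mu> \<rightarrow>\<^sub>M unitary_borel d"
    unfolding unitary_borel_def
  proof (rule measurable_vimage_algebra2)
    show "(\<lambda>U. V * U) \<in> space \<mu> \<rightarrow> unitary_group d"
      using unitary_group_mult[OF V] by (auto simp: haar_space[OF haar])
    show "(\<lambda>U. \<lambda>p\<in>{..<d} \<times> {..<d}. (V * U) $$ p) \<in> \<mu> \<rightarrow>\<^sub>M ?N"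
    proof (rule measurable_restrict)
      fix p assume "p \<in> {..<d} \<times> {..<d}"
      then obtain r s where p: "p = (r, s)" "r < d" "s < d" by auto
      have "(\<lambda>U. \<Sum>k<d. V $$ (r, k) * U $$ (k, s)) \<in> borel_measurable \<mu>"
        using p by (intro borel_measurable_sum borel_measurable_times borel_measurable_const haar_entry_measurable[OF haar]) auto
      also have "?this \<longleftrightarrow> (\<lambda>U. (V * U) $$ p) \<in> borel_measurable \<mu>"
      proof (rule measurable_cong)
        fix U assume "U \<in> space \<mu>"
        then have "U \<in> carrier_mat d d" "V \<in> carrier_mat d d"
          using V by (auto simp: haar_space[OF haar] unitary_group_def)
        then show "(\<Sum>k<d. V $$ (r, k) * U $$ (k, s)) = (V * U) $$ p"
          using p mat_times_index_sum[of V d d U d r s] by simp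
      qed
      finally show "(\<lambda>U. (V * U) $$ p) \<in> borel_measurable \<mu>" .
    qed
  qed
  also have "\<mu> \<rightarrow>\<^sub>M unitary_borel d = \<mu> \<rightarrow>\<^sub>M \<mu>"
    using haar by (intro measurable_cong_sets) (auto simp: haar_prob_measure_def)
  finally show ?thesis .
qed

text \<open>Invariance is given for images, while \<open>distr\<close> uses preimages. The preimage
  of \<open>A\<close> under multiplication by \<open>V\<close> is the image of \<open>A\<close>
  under the adjoint of \<open>V\<close>, which is again unitary.\<close>

lemma haar_distr_left:
  assumes haar: "haar_prob_measure d \<mu>" and V: "V \<in> unitary_group d"
  shows "distr \<mu> \<mu> (\<lambda>U. V * U) = \<mu>"
proof (rule measure_eqI)
  fix A assume "A \<in> sets (distr \<mu> \<mu> (\<lambda>U. V * U))"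
  then have A: "A \<in> sets \<mu>" by simp
  let ?V = "mat_adjoint V"
  have V': "?V \<in> unitary_group d" using V by (rule unitary_group_adjoint)
  have inv: "V * (?V * U) = U" "?V * (V * U) = U" if "U \<in> unitary_group d" for U
  proof -
    have "V \<in> carrier_mat d d" "?V \<in> carrier_mat d d" "U \<in> carrier_mat d d"
      "V * ?V = 1\<^sub>m d" "?V * V = 1\<^sub>m d"
      using V V' that by (auto simp: unitary_group_def)
    then show "V * (?V * U) = U" "?V * (V * U) = U"
      by (simp_all flip: assoc_mult_mat[of _ d d _ d _ d])
  qed
  have "A \<subseteq> unitary_group d"
    using sets.sets_into_space[OF A] by (simp add: haar_space[OF haar])
  then have "(\<lambda>U. V * U) -` A \<inter> space \<mu> = (\<lambda>U. ?V * U) ` A"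
    using inv unitary_group_mult[OF V'] unfolding haar_space[OF haar]
    by (auto simp: image_iff subset_iff) metis
  with A haar V' haar_left_measurable[OF haar V]
  show "emeasure (distr \<mu> \<mu> (\<lambda>U. V * U)) A = emeasure \<mu> A"
    by (simp add: emeasure_distr haar_prob_measure_def)
qed simp

subsection \<open>Moments of a matrix entry\<close>

text \<open>Pads a polynomial in \<open>t\<^sup>2\<close> with zero odd coefficients, so that it can
  be compared with a polynomial in \<open>t\<close> coefficient by coefficient.\<close>

lemma sum_even_powers:
  fixes g :: "nat \<Rightarrow> real"
  shows "(\<Sum>k\<le>2*n. (if even k then g (k div 2) else 0) * t ^ k) = (\<Sum>k\<le>n. g k * (t\<^sup>2) ^ k)"
  by (induction n) (simp_all add: power_mult power2_eq_square)

text \<open>The coefficients of \<open>t\<^sup>2\<close> in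
  \<open>E (X + t Y) ^ (2 * Suc n) = (1 + t\<^sup>2) ^ Suc n * m\<close> are compared,
  \<open>m\<close> being the moment of \<open>X\<close> on the right-hand side of the claim.\<close>

lemma (in prob_space) even_moment_rotation_invariant:
  fixes X Y :: "'a \<Rightarrow> real"
  assumes [measurable]: "random_variable borel X" "random_variable borel Y"
    and X: "\<And>\<omega>. \<omega> \<in> space M \<Longrightarrow> \<bar>X \<omega>\<bar> \<le> 1"
    and Y: "\<And>\<omega>. \<omega> \<in> space M \<Longrightarrow> \<bar>Y \<omega>\<bar> \<le> 1"
    and rot: "\<And>\<alpha> \<beta>. \<alpha>\<^sup>2 + \<beta>\<^sup>2 = 1 \<Longrightarrow>
      expectation (\<lambda>\<omega>. (\<alpha> * X \<omega> + \<beta> * Y \<omega>) ^ (2 * Suc n)) = expectation (\<lambda>\<omega>. X \<omega> ^ (2 * Suc n))"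
  shows "real (2 * n + 1) * expectation (\<lambda>\<omega>. X \<omega> ^ (2 * n) * (Y \<omega>)\<^sup>2) =
    expectation (\<lambda>\<omega>. X \<omega> ^ (2 * Suc n))"
proof -
  define m where "m = expectation (\<lambda>\<omega>. X \<omega> ^ (2 * Suc n))"
  have int: "integrable M (\<lambda>\<omega>. Y \<omega> ^ k * X \<omega> ^ l)" for k l
    by (rule integrable_const_bound[where B = 1])
      (use X Y in \<open>auto simp: abs_mult power_abs intro!: mult_le_one power_le_one\<close>)
  have "(\<Sum>k\<le>2 * Suc n. (real (2 * Suc n choose k) * expectation (\<lambda>\<omega>. Y \<omega> ^ k * X \<omega> ^ (2 * Suc n - k))) * t ^ k)
      = (\<Sum>k\<le>2 * Suc n. (if even k then real (Suc n choose (k div 2)) * m else 0) * t ^ k)" for t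
  proof -
    \<comment> \<open>Dividing \<open>(1, t)\<close> by its length \<open>r\<close> gives a point of
      the unit circle, to which \<open>rot\<close> applies.\<close>
    define r where "r = sqrt (1 + t\<^sup>2)"
    have r: "r > 0" "r\<^sup>2 = 1 + t\<^sup>2"
      by (auto simp: r_def add_pos_nonneg)
    have "(1 / r)\<^sup>2 + (t / r)\<^sup>2 = 1"
    proof -
      have "(1 / r)\<^sup>2 + (t / r)\<^sup>2 = (1 + t\<^sup>2) / r\<^sup>2"
        by (simp add: power_divide add_divide_distrib)
      also have "\<dots> = 1"
        using r(1) unfolding r(2)[symmetric] by simp
      finally show ?thesis .
    qed
    from rot[OF this] have "r ^ (2 * Suc n) * m =
        r ^ (2 * Suc n) * expectation (\<lambda>\<omega>. (1 / r * X \<omega> + t / r * Y \<omega>) ^ (2 * Suc n))"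
      by (simp add: m_def)
    also have "\<dots> = expectation (\<lambda>\<omega>. (r * (1 / r * X \<omega> + t / r * Y \<omega>)) ^ (2 * Suc n))"
      by (simp only: power_mult_distrib integral_mult_right_zero)
    also have "(\<lambda>\<omega>. r * (1 / r * X \<omega> + t / r * Y \<omega>)) = (\<lambda>\<omega>. t * Y \<omega> + X \<omega>)"
      using r(1) by (simp add: distrib_left add.commute)
    also have "expectation (\<lambda>\<omega>. (t * Y \<omega> + X \<omega>) ^ (2 * Suc n)) =
      expectation (\<lambda>\<omega>. \<Sum>k\<le>2 * Suc n. (real (2 * Suc n choose k) * t ^ k) * (Y \<omega> ^ k * X \<omega> ^ (2 * Suc n - k)))"
      by (subst binomial_ring) (simp only: power_mult_distrib ac_simps)
    also have "\<dots> = (\<Sum>k\<le>2 * Suc n. (real (2 * Suc n choose k) * t ^ k) *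
        expectation (\<lambda>\<omega>. Y \<omega> ^ k * X \<omega> ^ (2 * Suc n - k)))"
      by (subst Bochner_Integration.integral_sum) (auto intro: int simp del: mult_Suc_right)
    finally have "(\<Sum>k\<le>2 * Suc n. (real (2 * Suc n choose k) *
        expectation (\<lambda>\<omega>. Y \<omega> ^ k * X \<omega> ^ (2 * Suc n - k))) * t ^ k) = r ^ (2 * Suc n) * m"
      by (simp only: ac_simps)
    also have "r ^ (2 * Suc n) = (t\<^sup>2 + 1) ^ Suc n"
      by (simp only: power_mult r add.commute)
    also have "\<dots> = (\<Sum>k\<le>Suc n. real (Suc n choose k) * (t\<^sup>2) ^ k)"
      by (subst binomial_ring) simp
    also have "\<dots> * m = (\<Sum>k\<le>Suc n. (real (Suc n choose k) * m) * (t\<^sup>2) ^ k)"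
      by (simp only: sum_distrib_left ac_simps)
    finally show ?thesis
      by (simp only: sum_even_powers[of "\<lambda>k. real (Suc n choose k) * m"])
  qed
  \<comment> \<open>Both sides are polynomials in \<open>t\<close> that agree at every real
    \<open>t\<close>, so their coefficients agree.\<close>
  then have "\<forall>k\<le>2 * Suc n. real (2 * Suc n choose k) * expectation (\<lambda>\<omega>. Y \<omega> ^ k * X \<omega> ^ (2 * Suc n - k))
      = (if even k then real (Suc n choose (k div 2)) * m else 0)"
    by (subst polyfun_eq_coeffs[symmetric]) blast
  from this[rule_format, of 2]
  have "real (2 * Suc n choose 2) * expectation (\<lambda>\<omega>. X \<omega> ^ (2 * n) * (Y \<omega>)\<^sup>2) = real (Suc n) * m"
    by (simp add: mult.commute)
  \<comment> \<open>The factor \<open>Suc n\<close> also stands on the right, as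
    \<open>Suc n choose 1\<close>; cancelling it leaves \<open>2 * n + 1\<close>.\<close>
  moreover have "real (2 * Suc n choose 2) = real (Suc n) * real (2 * n + 1)"
  proof -
    have "2 * Suc n choose 2 = Suc n * (2 * n + 1)"
      by (simp add: choose_two)
    then show ?thesis by (simp only: of_nat_mult)
  qed
  ultimately have "real (Suc n) * (real (2 * n + 1) * expectation (\<lambda>\<omega>. X \<omega> ^ (2 * n) * (Y \<omega>)\<^sup>2)) = real (Suc n) * m"
    by (simp only: mult.assoc)
  then show ?thesis
    unfolding m_def by (simp only: mult_cancel_left) simp
qed

text \<open>Indices count from 0: \<open>a\<close> is the row of the entry under study and
  \<open>b\<close> its column. Left multiplication acts within column \<open>b\<close>.\<close>

locale haar_entry = prob_space \<mu> for \<mu> :: "complex mat measure" +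
  fixes d a b :: nat
  assumes haar: "haar_prob_measure d \<mu>" and a: "a < d" and b: "b < d"
begin

lemma entry_measurable [measurable]: "k < d \<Longrightarrow> (\<lambda>U. U $$ (k, b)) \<in> borel_measurable \<mu>"
  using haar_entry_measurable[OF haar _ b] .

lemma entry_measurable_a [measurable]: "(\<lambda>U. U $$ (a, b)) \<in> borel_measurable \<mu>"
  using a by (rule entry_measurable)

lemma space_carrier: "U \<in> space \<mu> \<Longrightarrow> U \<in> carrier_mat d d"
  by (simp add: haar_space[OF haar] unitary_group_def)

lemma column_norm: "U \<in> space \<mu> \<Longrightarrow> (\<Sum>k<d. (cmod (U $$ (k, b)))\<^sup>2) = 1"
  using unitary_column_norm b by (simp add: haar_space[OF haar])

lemma entry_le_1:
  assumes "U \<in> space \<mu>" "k < d"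
  shows "cmod (U $$ (k, b)) \<le> 1"
proof -
  have "(cmod (U $$ (k, b)))\<^sup>2 \<le> (\<Sum>k<d. (cmod (U $$ (k, b)))\<^sup>2)"
    by (rule member_le_sum) (use assms in auto)
  then show ?thesis
    using column_norm[OF assms(1)] by (simp add: abs_square_le_1)
qed

lemma Re_entry_le_1: "U \<in> space \<mu> \<Longrightarrow> k < d \<Longrightarrow> \<bar>Re (U $$ (k, b))\<bar> \<le> 1"
  and Im_entry_le_1: "U \<in> space \<mu> \<Longrightarrow> k < d \<Longrightarrow> \<bar>Im (U $$ (k, b))\<bar> \<le> 1"
  using entry_le_1 abs_Re_le_cmod abs_Im_le_cmod order_trans by blast+

text \<open>The sum is entry \<open>(a, b)\<close> of \<open>V * U\<close>, which has the same law
  as that of \<open>U\<close>.\<close>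

lemma expectation_left:
  fixes g :: "complex \<Rightarrow> real"
  assumes V: "V \<in> unitary_group d" and [measurable]: "g \<in> borel_measurable borel"
  shows "expectation (\<lambda>U. g (\<Sum>k<d. V $$ (a, k) * U $$ (k, b))) = expectation (\<lambda>U. g (U $$ (a, b)))"
proof -
  have "expectation (\<lambda>U. g (U $$ (a, b))) = (\<integral>U. g (U $$ (a, b)) \<partial>distr \<mu> \<mu> (\<lambda>U. V * U))"
    by (simp add: haar_distr_left[OF haar V])
  also have "\<dots> = expectation (\<lambda>U. g ((V * U) $$ (a, b)))"
    using haar_left_measurable[OF haar V] by (rule integral_distr) measurable
  also have "\<dots> = expectation (\<lambda>U. g (\<Sum>k<d. V $$ (a, k) * U $$ (k, b)))"
    using V space_carrier a b
    by (intro Bochner_Integration.integral_cong refl arg_cong[where f = g] mat_times_index_sum)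
      (auto simp: unitary_group_def)
  finally show ?thesis ..
qed

lemma expectation_phase:
  fixes g :: "complex \<Rightarrow> real"
  assumes "cmod c = 1" "g \<in> borel_measurable borel"
  shows "expectation (\<lambda>U. g (c * U $$ (a, b))) = expectation (\<lambda>U. g (U $$ (a, b)))"
proof -
  have "(\<Sum>k<d. (c \<cdot>\<^sub>m 1\<^sub>m d) $$ (a, k) * U $$ (k, b)) = (\<Sum>k<d. if k = a then c * U $$ (k, b) else 0)" for U
    using a by (intro sum.cong) auto
  with expectation_left[OF scalar_unitary[OF assms(1)] assms(2)] a show ?thesis
    by simp
qed

lemma expectation_rotate:
  fixes g :: "complex \<Rightarrow> real"
  assumes "k < d" "k \<noteq> a" "\<alpha>\<^sup>2 + (cmod \<gamma>)\<^sup>2 = 1" "g \<in> borel_measurable borel"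
  shows "expectation (\<lambda>U. g (of_real \<alpha> * U $$ (a, b) + \<gamma> * U $$ (k, b))) = expectation (\<lambda>U. g (U $$ (a, b)))"
proof -
  have "(\<Sum>l<d. givens d a k \<alpha> \<gamma> $$ (a, l) * U $$ (l, b)) = of_real \<alpha> * U $$ (a, b) + \<gamma> * U $$ (k, b)" for U
    using a assms(1,2) by (subst sum_supported_on_pair[of a d k]) (auto simp: givens_def)
  then show ?thesis
    using expectation_left[OF givens_unitary[OF a assms(1) assms(2)[symmetric] assms(3)] assms(4)]
    by (simp only:)
qed

section \<open>Recursion and closed form for the even moments\<close>

definition even_moment :: "nat \<Rightarrow> real" where
  "even_moment n = expectation (\<lambda>U. Re (U $$ (a, b)) ^ (2 * n))"

lemma even_moment_0: "even_moment 0 = 1"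
  by (simp add: even_moment_def prob_space)

text \<open>Rotation with the real coefficient \<open>\<gamma> = \<beta>\<close>. For
  \<open>k = a\<close> the mixed moment is \<open>even_moment (Suc n)\<close> itself, without the
  factor \<open>2 * n + 1\<close>.\<close>

lemma mixed_moment_Re:
  assumes "k < d" "k \<noteq> a"
  shows "real (2 * n + 1) * expectation (\<lambda>U. Re (U $$ (a, b)) ^ (2 * n) * (Re (U $$ (k, b)))\<^sup>2) = even_moment (Suc n)"
  unfolding even_moment_def
proof (rule even_moment_rotation_invariant)
  fix \<alpha> \<beta> :: real assume "\<alpha>\<^sup>2 + \<beta>\<^sup>2 = 1"
  then show "expectation (\<lambda>U. (\<alpha> * Re (U $$ (a, b)) + \<beta> * Re (U $$ (k, b))) ^ (2 * Suc n)) =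
      expectation (\<lambda>U. Re (U $$ (a, b)) ^ (2 * Suc n))"
    using expectation_rotate[OF assms, of \<alpha> "of_real \<beta>" "\<lambda>w. Re w ^ (2 * Suc n)"] by simp
qed (use assms a Re_entry_le_1 in auto)

lemma mixed_moment_Im:
  assumes "k < d"
  shows "real (2 * n + 1) * expectation (\<lambda>U. Re (U $$ (a, b)) ^ (2 * n) * (Im (U $$ (k, b)))\<^sup>2) = even_moment (Suc n)"
  unfolding even_moment_def
proof (rule even_moment_rotation_invariant)
  fix \<alpha> \<beta> :: real assume 1: "\<alpha>\<^sup>2 + \<beta>\<^sup>2 = 1"
  show "expectation (\<lambda>U. (\<alpha> * Re (U $$ (a, b)) + \<beta> * Im (U $$ (k, b))) ^ (2 * Suc n)) =
      expectation (\<lambda>U. Re (U $$ (a, b)) ^ (2 * Suc n))"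
  proof (cases "k = a")
    case True
    \<comment> \<open>Within a single entry a phase takes the place of the rotation: the real part
      of \<open>(\<alpha> - \<i> \<beta>) w\<close> is
      \<open>\<alpha> * Re w + \<beta> * Im w\<close>.\<close>
    have "cmod (Complex \<alpha> (- \<beta>)) = 1"
      using 1 by (simp add: cmod_def)
    from expectation_phase[OF this, of "\<lambda>w. Re w ^ (2 * Suc n)"] True show ?thesis
      by simp
  next
    case False
    with 1 show ?thesis
      \<comment> \<open>The factor \<open>- \<i>\<close> turns the imaginary part of the second
        entry into a real part.\<close>
      using expectation_rotate[OF assms, of \<alpha> "- \<i> * of_real \<beta>" "\<lambda>w. Re w ^ (2 * Suc n)"]
      by (simp add: norm_mult)
  qed
qed (use assms a Re_entry_le_1 Im_entry_le_1 in auto)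

lemma integrable_Re_power_times:
  assumes [measurable]: "random_variable borel Y" and "\<And>U. U \<in> space \<mu> \<Longrightarrow> \<bar>Y U\<bar> \<le> 1"
  shows "integrable \<mu> (\<lambda>U. Re (U $$ (a, b)) ^ n * (Y U)\<^sup>2)"
proof (rule integrable_const_bound[where B = 1])
  have "norm (Re (U $$ (a, b)) ^ n * (Y U)\<^sup>2) \<le> 1" if "U \<in> space \<mu>" for U
    unfolding norm_mult norm_power
    using assms(2) Re_entry_le_1 a that by (intro mult_le_one power_le_one) auto
  then show "AE U in \<mu>. norm (Re (U $$ (a, b)) ^ n * (Y U)\<^sup>2) \<le> 1"
    by (rule AE_I2)
qed measurable

text \<open>The factor 1, written as the sum of all squares in the column, is inserted into the
  moment. After multiplication by \<open>2 * n + 1\<close>, each of the \<open>2 d - 1\<close> other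
  coordinates contributes one \<open>even_moment (Suc n)\<close> and \<open>Re\<close> of entry
  \<open>a\<close> contributes \<open>2 n + 1\<close>, in total \<open>2 (d + n)\<close>.\<close>

lemma even_moment_Suc:
  "real (2 * n + 1) * even_moment n = 2 * real (d + n) * even_moment (Suc n)"
proof -
  let ?X = "\<lambda>U :: complex mat. Re (U $$ (a, b)) ^ (2 * n)"
  have "even_moment n = expectation (\<lambda>U. \<Sum>k<d. ?X U * (Re (U $$ (k, b)))\<^sup>2 + ?X U * (Im (U $$ (k, b)))\<^sup>2)"
    unfolding even_moment_def
  proof (intro Bochner_Integration.integral_cong refl)
    fix U assume "U \<in> space \<mu>"
    then show "?X U = (\<Sum>k<d. ?X U * (Re (U $$ (k, b)))\<^sup>2 + ?X U * (Im (U $$ (k, b)))\<^sup>2)"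
      using column_norm by (simp add: cmod_power2 flip: distrib_left sum_distrib_left)
  qed
  also have "\<dots> = (\<Sum>k<d. expectation (\<lambda>U. ?X U * (Re (U $$ (k, b)))\<^sup>2) + expectation (\<lambda>U. ?X U * (Im (U $$ (k, b)))\<^sup>2))"
  proof -
    have "integrable \<mu> (\<lambda>U. ?X U * (Re (U $$ (k, b)))\<^sup>2)" "integrable \<mu> (\<lambda>U. ?X U * (Im (U $$ (k, b)))\<^sup>2)"
      if "k \<in> {..<d}" for k
      using that Re_entry_le_1 Im_entry_le_1 by (auto intro!: integrable_Re_power_times)
    note i = this
    have "expectation (\<lambda>U. \<Sum>k<d. ?X U * (Re (U $$ (k, b)))\<^sup>2 + ?X U * (Im (U $$ (k, b)))\<^sup>2) =
        (\<Sum>k<d. expectation (\<lambda>U. ?X U * (Re (U $$ (k, b)))\<^sup>2 + ?X U * (Im (U $$ (k, b)))\<^sup>2))"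
      by (intro Bochner_Integration.integral_sum Bochner_Integration.integrable_add i)
    also have "\<dots> = (\<Sum>k<d. expectation (\<lambda>U. ?X U * (Re (U $$ (k, b)))\<^sup>2) + expectation (\<lambda>U. ?X U * (Im (U $$ (k, b)))\<^sup>2))"
      by (intro sum.cong refl Bochner_Integration.integral_add i)
    finally show ?thesis .
  qed
  finally have "real (2 * n + 1) * even_moment n =
      (\<Sum>k<d. real (2 * n + 1) * expectation (\<lambda>U. ?X U * (Re (U $$ (k, b)))\<^sup>2) + real (2 * n + 1) * expectation (\<lambda>U. ?X U * (Im (U $$ (k, b)))\<^sup>2))"
    by (simp only: sum_distrib_left distrib_left)
  \<comment> \<open>Every \<open>k\<close> is counted with weight 2; the surplus at
    \<open>k = a\<close> is \<open>(2 n + 1) - 1\<close>.\<close>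
  also have "\<dots> = (\<Sum>k<d. (if k = a then real (2 * n) * even_moment (Suc n) else 0) + 2 * even_moment (Suc n))"
  proof (rule sum.cong)
    fix k assume k: "k \<in> {..<d}"
    have "real (2 * n + 1) * expectation (\<lambda>U. ?X U * (Re (U $$ (k, b)))\<^sup>2) =
        (if k = a then real (2 * n + 1) else 1) * even_moment (Suc n)"
      using k mixed_moment_Re[of k n] by (auto simp: even_moment_def power2_eq_square mult_ac)
    moreover have "real (2 * n + 1) * expectation (\<lambda>U. ?X U * (Im (U $$ (k, b)))\<^sup>2) = even_moment (Suc n)"
      using k by (intro mixed_moment_Im) auto
    ultimately show "real (2 * n + 1) * expectation (\<lambda>U. ?X U * (Re (U $$ (k, b)))\<^sup>2) + real (2 * n + 1) * expectation (\<lambda>U. ?X U * (Im (U $$ (k, b)))\<^sup>2) =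
        (if k = a then real (2 * n) * even_moment (Suc n) else 0) + 2 * even_moment (Suc n)"
      by (simp only:) (simp add: algebra_simps)
  qed simp
  also have "\<dots> = 2 * real (d + n) * even_moment (Suc n)"
    using a by (simp add: sum.distrib algebra_simps)
  finally show ?thesis .
qed

text \<open>The recursion solved. The first factor is the moment of order \<open>2 * n\<close> of a
  centred Gaussian of variance 1/2; the product is the correction for finite
  \<open>d\<close>.\<close>

lemma even_moment_eq:
  "real d ^ n * even_moment n = fact (2 * n) / (4 ^ n * fact n) * (\<Prod>l<n. real d / real (d + l))"
proof (induction n)
  case 0
  then show ?case by (simp add: even_moment_0)
next
  case (Suc n)
  have d: "real d + real n > 0" using a by simp
  have rec: "even_moment (Suc n) = real (2 * n + 1) / (2 * real (d + n)) * even_moment n"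
    using even_moment_Suc[of n] d by (simp add: field_simps)
  have "real d ^ Suc n * even_moment (Suc n) =
      real d * real (2 * n + 1) / (2 * real (d + n)) * (real d ^ n * even_moment n)"
    by (simp add: rec)
  also have "\<dots> = (real (2 * n + 1) / 2 * (fact (2 * n) / (4 ^ n * fact n))) * ((\<Prod>l<n. real d / real (d + l)) * (real d / real (d + n)))"
  proof -
    have "x * y / (2 * w) * (A * B) = (y / 2 * A) * (B * (x / w))" for x y w A B :: real
      by simp
    then show ?thesis
      unfolding Suc.IH by (simp only:)
  qed
  also have "real (2 * n + 1) / 2 * (fact (2 * n) / (4 ^ n * fact n)) = fact (2 * Suc n) / (4 ^ Suc n * fact (Suc n))"
    by (simp add: divide_simps)
  also have "(\<Prod>l<n. real d / real (d + l)) * (real d / real (d + n)) = (\<Prod>l<Suc n. real d / real (d + l))"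
    by simp
  finally show ?case .
qed

text \<open>The cosine series is integrated term by term, and \<open>fact (2 * n)\<close> cancels
  against the moment formula.\<close>

lemma expectation_cos_sums:
  "(\<lambda>n. (- (r\<^sup>2 / 4)) ^ n / fact n * (\<Prod>l<n. real d / real (d + l)))
     sums expectation (\<lambda>U. cos (r * (sqrt (real d) * Re (U $$ (a, b)))))"
proof -
  define s where "s = r * sqrt (real d)"
  let ?f = "\<lambda>n U. (- 1) ^ n / fact (2 * n) * (s * Re (U $$ (a, b))) ^ (2 * n)"
  have bound: "norm (?f n U) \<le> (s\<^sup>2) ^ n / fact n" if "U \<in> space \<mu>" for n U
  proof -
    have "\<bar>s * Re (U $$ (a, b))\<bar> \<le> \<bar>s\<bar>"
      using Re_entry_le_1[OF that a] by (simp add: abs_mult mult_left_le)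
    then have "\<bar>s * Re (U $$ (a, b))\<bar> ^ (2 * n) \<le> \<bar>s\<bar> ^ (2 * n)"
      by (intro power_mono) auto
    then have "norm (?f n U) \<le> (s\<^sup>2) ^ n / fact (2 * n)"
      by (simp add: abs_mult power_abs power_mult divide_right_mono)
    \<comment> \<open>Weakening the factorial makes the dominating series the exponential series of
      \<open>s\<^sup>2\<close>.\<close>
    also have "\<dots> \<le> (s\<^sup>2) ^ n / fact n"
      by (intro divide_left_mono fact_mono) auto
    finally show ?thesis .
  qed
  have sum: "summable (\<lambda>n. (s\<^sup>2) ^ n / fact n)"
    using summable_exp[of "s\<^sup>2"] by (simp add: field_simps)
  have int: "integrable \<mu> (?f n)" for n
    by (rule integrable_const_bound[where B = "(s\<^sup>2) ^ n / fact n"]) (use bound in auto)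
  have "(\<lambda>n. expectation (?f n)) sums expectation (\<lambda>U. \<Sum>n. ?f n U)"
  proof (rule sums_integral[OF int])
    show "AE U in \<mu>. summable (\<lambda>n. norm (?f n U))"
      by (intro AE_I2 summable_comparison_test[OF _ sum]) (use bound in auto)
    show "summable (\<lambda>n. expectation (\<lambda>U. norm (?f n U)))"
    proof (intro summable_comparison_test[OF _ sum] exI allI impI)
      fix n
      have "expectation (\<lambda>U. norm (?f n U)) \<le> expectation (\<lambda>U. (s\<^sup>2) ^ n / fact n)"
        by (intro integral_mono integrable_norm int bound integrable_const)
      then show "norm (expectation (\<lambda>U. norm (?f n U))) \<le> (s\<^sup>2) ^ n / fact n"
        by (simp add: prob_space)
    qed
  qed
  also have "(\<lambda>U. \<Sum>n. ?f n U) = (\<lambda>U. cos (r * (sqrt (real d) * Re (U $$ (a, b)))))"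
    using cos_paired by (auto simp: sums_iff s_def mult.assoc)
  also have "(\<lambda>n. expectation (?f n)) = (\<lambda>n. (- (r\<^sup>2 / 4)) ^ n / fact n * (\<Prod>l<n. real d / real (d + l)))"
  proof
    fix n
    have "expectation (?f n) = ((- 1) ^ n / fact (2 * n) * s ^ (2 * n)) * even_moment n"
      by (simp add: power_mult_distrib even_moment_def)
    also have "s ^ (2 * n) = (r\<^sup>2) ^ n * real d ^ n"
      by (simp add: s_def power_mult power_mult_distrib)
    also have "(- 1) ^ n / fact (2 * n) * ((r\<^sup>2) ^ n * real d ^ n) * even_moment n =
      (- 1) ^ n / fact (2 * n) * (r\<^sup>2) ^ n * (real d ^ n * even_moment n)"
      by simp
    also have "\<dots> = ((- 1) ^ n * (r\<^sup>2) ^ n / 4 ^ n) / fact n * (\<Prod>l<n. real d / real (d + l))"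
      unfolding even_moment_eq by simp
    also have "(- 1) ^ n * (r\<^sup>2) ^ n / 4 ^ n = (- (r\<^sup>2 / 4)) ^ n"
      by (simp only: power_minus[of "r\<^sup>2 / 4" n] power_divide times_divide_eq_right)
    finally show "expectation (?f n) = (- (r\<^sup>2 / 4)) ^ n / fact n * (\<Prod>l<n. real d / real (d + l))" .
  qed
  finally show ?thesis .
qed

text \<open>A phase turns \<open>\<zeta>\<close> onto the positive real axis, so the law of the real
  part determines every one-dimensional projection.\<close>

lemma expectation_inner:
  fixes g :: "real \<Rightarrow> real"
  assumes "g \<in> borel_measurable borel"
  shows "expectation (\<lambda>U. g (inner \<zeta> (of_real t * U $$ (a, b)))) = expectation (\<lambda>U. g (cmod \<zeta> * (t * Re (U $$ (a, b)))))"
proof -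
  \<comment> \<open>For \<open>\<zeta> = 0\<close> any number of modulus 1 would do.\<close>
  define c where "c = (if \<zeta> = 0 then 1 else cnj \<zeta> / of_real (cmod \<zeta>))"
  have "cmod c = 1"
    by (simp add: c_def norm_divide)
  have c: "cnj \<zeta> = of_real (cmod \<zeta>) * c"
    by (simp add: c_def)
  have "inner \<zeta> (of_real t * w) = cmod \<zeta> * (t * Re (c * w))" for w
  proof -
    have "inner \<zeta> (of_real t * w) = Re (cnj \<zeta> * (of_real t * w))"
      by (simp add: inner_complex_def)
    also have "cnj \<zeta> * (of_real t * w) = of_real (cmod \<zeta> * t) * (c * w)"
      by (simp add: c)
    finally show ?thesis by simp
  qed
  then show ?thesis
    using expectation_phase[OF \<open>cmod c = 1\<close>, of "\<lambda>w. g (cmod \<zeta> * (t * Re w))"] assms by simp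
qed

text \<open>The phase -1 shows that the law is symmetric, and the sine is odd.\<close>

lemma expectation_sin_inner:
  "expectation (\<lambda>U. sin (inner \<zeta> (of_real t * U $$ (a, b)))) = 0"
proof -
  have "expectation (\<lambda>U. sin (inner \<zeta> (of_real t * U $$ (a, b)))) =
      expectation (\<lambda>U. sin (inner \<zeta> (of_real t * (- 1 * U $$ (a, b)))))"
    by (rule expectation_phase[symmetric]) auto
  then show ?thesis by simp
qed

lemma expectation_cmod_square: "expectation (\<lambda>U. (cmod (U $$ (a, b)))\<^sup>2) = 1 / real d"
proof -
  have "integrable \<mu> (\<lambda>U. (Re (U $$ (a, b)))\<^sup>2)" "integrable \<mu> (\<lambda>U. (Im (U $$ (a, b)))\<^sup>2)"
    using integrable_Re_power_times[of "\<lambda>U. Re (U $$ (a, b))" 0]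
      integrable_Re_power_times[of "\<lambda>U. Im (U $$ (a, b))" 0] Re_entry_le_1 Im_entry_le_1 a by simp_all
  then have "expectation (\<lambda>U. (cmod (U $$ (a, b)))\<^sup>2) = even_moment 1 + expectation (\<lambda>U. (Im (U $$ (a, b)))\<^sup>2)"
    by (simp add: cmod_power2 even_moment_def)
  also have "\<dots> = 2 * even_moment 1"
    using mixed_moment_Im[OF a, of 0] by simp
  also have "\<dots> = 1 / real d"
    using even_moment_Suc[of 0] a by (simp add: even_moment_0 field_simps)
  finally show ?thesis .
qed

text \<open>Markov's inequality for the squared modulus. The bound does not depend on
  \<open>d\<close>, which yields tightness.\<close>

lemma scaled_entry_tail:
  assumes "R > 0"
  shows "prob {U \<in> space \<mu>. R \<le> cmod (of_real (sqrt (real d)) * U $$ (a, b))} \<le> 1 / R\<^sup>2"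
proof -
  have int: "integrable \<mu> (\<lambda>U. real d * (cmod (U $$ (a, b)))\<^sup>2)"
    using entry_le_1 a by (intro integrable_mult_right integrable_const_bound[where B = 1]) (auto simp: abs_square_le_1)
  have "R \<le> cmod (of_real (sqrt (real d)) * w) \<longleftrightarrow> R\<^sup>2 \<le> real d * (cmod w)\<^sup>2" for w
  proof -
    have "R \<le> cmod (of_real (sqrt (real d)) * w) \<longleftrightarrow> R\<^sup>2 \<le> (cmod (of_real (sqrt (real d)) * w))\<^sup>2"
      using assms by (intro abs_le_square_iff[of R "cmod (of_real (sqrt (real d)) * w)", simplified abs_of_nonneg[OF norm_ge_zero] abs_of_pos[OF assms]])
    then show ?thesis by (simp add: norm_mult power_mult_distrib)
  qed
  then have "prob {U \<in> space \<mu>. R \<le> cmod (of_real (sqrt (real d)) * U $$ (a, b))} =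
      prob {U \<in> space \<mu>. R\<^sup>2 \<le> real d * (cmod (U $$ (a, b)))\<^sup>2}"
    by simp
  also have "\<dots> \<le> expectation (\<lambda>U. real d * (cmod (U $$ (a, b)))\<^sup>2) / R\<^sup>2"
    using assms by (intro integral_Markov_inequality_measure[OF int, of "space \<mu>"]) auto
  also have "\<dots> = 1 / R\<^sup>2"
    using a by (simp add: expectation_cmod_square)
  finally show ?thesis .
qed

end

subsection \<open>The Gaussian limit\<close>

text \<open>Tannery's theorem: each product tends to 1 as \<open>d\<close> grows, and the terms are
  dominated by the exponential series of \<open>\<bar>x\<bar>\<close>.\<close>

lemma moment_series_tendsto:
  fixes x :: real
  shows "(\<lambda>d. \<Sum>n. x ^ n / fact n * (\<Prod>l<n. real d / real (d + l))) \<longlonglongrightarrow> exp x"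
proof -
  have "(\<lambda>d. \<Sum>n. x ^ n / fact n * (\<Prod>l<n. real d / real (d + l))) \<longlonglongrightarrow> (\<Sum>n. x ^ n / fact n)"
  proof (intro tannerys_theorem[THEN conjunct2, THEN conjunct2])
    fix n
    have "(\<lambda>d. real d / real (d + l)) \<longlonglongrightarrow> 1" for l
      by real_asymp
    then have "(\<lambda>d. x ^ n / fact n * (\<Prod>l<n. real d / real (d + l))) \<longlonglongrightarrow> x ^ n / fact n * (\<Prod>l<n. 1)"
      by (intro tendsto_intros)
    then show "(\<lambda>d. x ^ n / fact n * (\<Prod>l<n. real d / real (d + l))) \<longlonglongrightarrow> x ^ n / fact n"
      by simp
  next
    show "summable (\<lambda>n. \<bar>x\<bar> ^ n / fact n)"
      using summable_exp[of "\<bar>x\<bar>"] by (simp add: field_simps)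
    have "norm (x ^ n / fact n * (\<Prod>l<n. real d / real (d + l))) \<le> \<bar>x\<bar> ^ n / fact n" for n d
    proof -
      \<comment> \<open>This includes \<open>d = 0\<close>, where every quotient is 0, also the one
        with denominator 0.\<close>
      have "\<bar>\<Prod>l<n. real d / real (d + l)\<bar> \<le> 1"
        by (auto simp: abs_prod intro!: prod_le_1 divide_le_eq_1[THEN iffD2])
      then show ?thesis
        using mult_left_le[of _ "\<bar>x\<bar> ^ n / fact n"] by (simp add: abs_mult power_abs)
    qed
    then show "eventually (\<lambda>(n, d). norm (x ^ n / fact n * (\<Prod>l<n. real d / real (d + l))) \<le> \<bar>x\<bar> ^ n / fact n) (at_top \<times>\<^sub>F sequentially)"
      by (intro always_eventually) auto
  qed simp
  also have "(\<Sum>n. x ^ n / fact n) = exp x"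
    by (simp add: exp_def field_simps)
  finally show ?thesis .
qed

section \<open>Characteristic function of the complex Gaussian\<close>

lemma std_complex_gaussian_measurable:
  assumes "std_complex_gaussian M z"
  shows "z \<in> borel_measurable M"
  using assms unfolding std_complex_gaussian_def borel_measurable_complex_iff
  by (auto dest!: distributed_measurable)

text \<open>\<open>X\<close> is \<open>sqrt (1/2)\<close> times a standard normal variable. The
  scale \<open>s\<close> sits inside the variable and the argument is 1, as the product rule for
  sums of independent variables will require.\<close>

lemma (in prob_space) char_normal_half:
  assumes "distributed M lborel X (normal_density 0 (sqrt (1/2)))"
  shows "char (distr M borel (\<lambda>\<omega>. s * X \<omega>)) 1 = of_real (exp (- (s\<^sup>2 / 4)))"
proof -
  let ?Y = "\<lambda>\<omega>. (X \<omega> - 0) / sqrt (1/2)"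
  have Y: "distributed M lborel ?Y std_normal_density"
    using normal_standard_normal_convert[of "sqrt (1/2)" X 0] assms by simp
  have m: "X \<in> borel_measurable M" "?Y \<in> borel_measurable M"
    using distributed_measurable[OF assms] distributed_measurable[OF Y] by simp_all
  have "distr M borel ?Y = std_normal_distribution"
    using distributed_distr_eq_density[OF Y] by (simp cong: distr_cong)
  then have "char (distr M borel ?Y) (s * sqrt (1/2)) = of_real (exp (- ((s * sqrt (1/2))\<^sup>2) / 2))"
    by (simp add: char_std_normal_distribution)
  moreover have "char (distr M borel ?Y) (s * sqrt (1/2)) = char (distr M borel (\<lambda>\<omega>. s * X \<omega>)) 1"
    using m by (simp add: char_def integral_distr real_sqrt_divide)
  ultimately show ?thesis
    by (simp add: power_mult_distrib power_divide real_sqrt_divide)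
qed

text \<open>The inner product is a sum of independent multiples of \<open>Re z\<close> and
  \<open>Im z\<close>, so the characteristic functions multiply and the exponents add up to
  \<open>(cmod \<zeta>)\<^sup>2 / 4\<close>.\<close>

lemma std_complex_gaussian_char:
  assumes z: "std_complex_gaussian M z"
  shows "(\<integral>\<omega>. iexp (inner \<zeta> (z \<omega>)) \<partial>M) = of_real (exp (- ((cmod \<zeta>)\<^sup>2 / 4)))"
proof -
  interpret prob_space M using z by (simp add: std_complex_gaussian_def)
  have [measurable]: "z \<in> borel_measurable M" using z by (rule std_complex_gaussian_measurable)
  have d: "distributed M lborel (\<lambda>\<omega>. Re (z \<omega>)) (normal_density 0 (sqrt (1/2)))"
    "distributed M lborel (\<lambda>\<omega>. Im (z \<omega>)) (normal_density 0 (sqrt (1/2)))"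
    and indep: "indep_var borel (\<lambda>\<omega>. Re (z \<omega>)) borel (\<lambda>\<omega>. Im (z \<omega>))"
    using z by (auto simp: std_complex_gaussian_def)
  have "indep_var borel (\<lambda>\<omega>. Re \<zeta> * Re (z \<omega>)) borel (\<lambda>\<omega>. Im \<zeta> * Im (z \<omega>))"
    using indep_var_compose[OF indep, of "\<lambda>x. Re \<zeta> * x" borel "\<lambda>x. Im \<zeta> * x" borel]
    by (simp add: comp_def)
  from char_distr_add[OF this, of 1]
  have "char (distr M borel (\<lambda>\<omega>. Re \<zeta> * Re (z \<omega>) + Im \<zeta> * Im (z \<omega>))) 1 =
      of_real (exp (- ((Re \<zeta>)\<^sup>2 / 4))) * of_real (exp (- ((Im \<zeta>)\<^sup>2 / 4)))"
    by (simp only: char_normal_half[OF d(1)] char_normal_half[OF d(2)])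
  also have "\<dots> = of_real (exp (- ((cmod \<zeta>)\<^sup>2 / 4)))"
    by (simp add: cmod_power2 add_divide_distrib flip: of_real_mult exp_add)
  also have "char (distr M borel (\<lambda>\<omega>. Re \<zeta> * Re (z \<omega>) + Im \<zeta> * Im (z \<omega>))) 1 = (\<integral>\<omega>. iexp (inner \<zeta> (z \<omega>)) \<partial>M)"
    by (simp add: char_def integral_distr inner_complex_def)
  finally show ?thesis .
qed

lemma std_complex_gaussian_cos_sin:
  assumes z: "std_complex_gaussian M z"
  shows "(\<integral>\<omega>. cos (inner \<zeta> (z \<omega>)) \<partial>M) = exp (- ((cmod \<zeta>)\<^sup>2 / 4))"
    and "(\<integral>\<omega>. sin (inner \<zeta> (z \<omega>)) \<partial>M) = 0"
proof -
  interpret prob_space M using z by (simp add: std_complex_gaussian_def)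
  have [measurable]: "z \<in> borel_measurable M" using z by (rule std_complex_gaussian_measurable)
  have "integrable M (\<lambda>\<omega>. iexp (inner \<zeta> (z \<omega>)))"
    by (intro integrable_iexp) auto
  from integral_Re[OF this] integral_Im[OF this]
  show "(\<integral>\<omega>. cos (inner \<zeta> (z \<omega>)) \<partial>M) = exp (- ((cmod \<zeta>)\<^sup>2 / 4))" "(\<integral>\<omega>. sin (inner \<zeta> (z \<omega>)) \<partial>M) = 0"
    by (simp_all add: std_complex_gaussian_char[OF z] Re_exp Im_exp del: integral_Re integral_Im)
qed

theorem corollary1p3:
  fixes i j :: nat
    and \<mu> :: "nat \<Rightarrow> complex mat measure"
    and M :: "'a measure"
    and z :: "'a \<Rightarrow> complex"
  assumes "i \<ge> 1" and "j \<ge> 1"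
    and "\<And>d. d \<ge> max i j \<Longrightarrow> haar_prob_measure d (\<mu> d)"
    and "std_complex_gaussian M z"
  shows "weak_conv_bdd_cont
           (\<lambda>d. distr (\<mu> d) borel (\<lambda>U. complex_of_real (sqrt (real d)) * U $$ (i - 1, j - 1)))
           (distr M borel z)"
proof -
  \<comment> \<open>The Haar hypothesis starts at this dimension, so the argument runs along the
    shifted sequence \<open>P\<close>.\<close>
  define N where "N = max i j"
  define X where "X d U = complex_of_real (sqrt (real d)) * U $$ (i - 1, j - 1)" for d and U :: "complex mat"
  interpret M: prob_space M using assms(4) by (simp add: std_complex_gaussian_def)
  have [measurable]: "z \<in> borel_measurable M"
    using assms(4) by (rule std_complex_gaussian_measurable)
  have entry: "haar_entry (\<mu> d) d (i - 1) (j - 1)" if "d \<ge> N" for d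
    using assms(1,2) assms(3)[of d] that
    by (auto simp: haar_entry_def haar_entry_axioms_def haar_prob_measure_def N_def)
  have X: "X d \<in> borel_measurable (\<mu> d)" if "d \<ge> N" for d
  proof -
    interpret haar_entry "\<mu> d" d "i - 1" "j - 1" using entry[OF that] .
    show ?thesis unfolding X_def by measurable
  qed
  define P where "P n = distr (\<mu> (n + N)) borel (X (n + N))" for n
  have "weak_conv_bdd_cont P (distr M borel z)"
  proof (rule weak_conv_complexI)
    show "prob_space (P n)" for n
      unfolding P_def using X[of "n + N"] entry[of "n + N"]
      by (intro prob_space.prob_space_distr) (auto simp: haar_entry_def)
    show "prob_space (distr M borel z)"
      by (rule M.prob_space_distr) simp
    show "sets (P n) = sets borel" "sets (distr M borel z) = sets borel" for n
      by (simp_all add: P_def)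
    show "\<exists>R. \<forall>n. measure (P n) {w. R \<le> cmod w} \<le> e" if "e > 0" for e
    proof (intro exI allI)
      fix n
      interpret haar_entry "\<mu> (n + N)" "n + N" "i - 1" "j - 1" by (rule entry) simp
      \<comment> \<open>The radius \<open>1 / sqrt e\<close> makes the tail bound
        \<open>1 / R\<^sup>2\<close> equal to \<open>e\<close>.\<close>
      have "measure (P n) {w. 1 / sqrt e \<le> cmod w} = prob {U \<in> space (\<mu> (n + N)). 1 / sqrt e \<le> cmod (X (n + N) U)}"
        unfolding P_def using X[of "n + N"] by (subst measure_distr) (auto intro!: arg_cong[where f = prob])
      also have "\<dots> \<le> 1 / (1 / sqrt e)\<^sup>2"
        unfolding X_def by (rule scaled_entry_tail) (use that in simp)
      finally show "measure (P n) {w. 1 / sqrt e \<le> cmod w} \<le> e"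
        using that by (simp add: power_divide)
    qed
    show "(\<lambda>n. \<integral>w. cos (inner \<zeta> w) \<partial>P n) \<longlonglongrightarrow> (\<integral>w. cos (inner \<zeta> w) \<partial>distr M borel z)" for \<zeta>
    proof -
      have "(\<integral>w. cos (inner \<zeta> w) \<partial>P n) =
          (\<Sum>k. (- ((cmod \<zeta>)\<^sup>2 / 4)) ^ k / fact k * (\<Prod>l<k. real (n + N) / real (n + N + l)))" for n
      proof -
        interpret haar_entry "\<mu> (n + N)" "n + N" "i - 1" "j - 1" by (rule entry) simp
        have "(\<integral>w. cos (inner \<zeta> w) \<partial>P n) = expectation (\<lambda>U. cos (inner \<zeta> (X (n + N) U)))"
          unfolding P_def using X[of "n + N"] by (subst integral_distr) auto
        also have "\<dots> = expectation (\<lambda>U. cos (cmod \<zeta> * (sqrt (real (n + N)) * Re (U $$ (i - 1, j - 1)))))"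
          unfolding X_def by (rule expectation_inner) simp
        finally show ?thesis
          using expectation_cos_sums[of "cmod \<zeta>"] by (simp only: sums_iff)
      qed
      moreover have "(\<integral>w. cos (inner \<zeta> w) \<partial>distr M borel z) = exp (- ((cmod \<zeta>)\<^sup>2 / 4))"
        by (subst integral_distr) (auto simp: std_complex_gaussian_cos_sin[OF assms(4)])
      \<comment> \<open>The limit of the series in the dimension is read off along the same shift by
        \<open>N\<close>.\<close>
      ultimately show ?thesis
        using LIMSEQ_ignore_initial_segment[OF moment_series_tendsto[of "- ((cmod \<zeta>)\<^sup>2 / 4)"], of N]
        by (simp only:)
    qed
    show "(\<lambda>n. \<integral>w. sin (inner \<zeta> w) \<partial>P n) \<longlonglongrightarrow> (\<integral>w. sin (inner \<zeta> w) \<partial>distr M borel z)" for \<zeta>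
    proof -
      have "(\<integral>w. sin (inner \<zeta> w) \<partial>P n) = 0" for n
      proof -
        interpret haar_entry "\<mu> (n + N)" "n + N" "i - 1" "j - 1" by (rule entry) simp
        have "(\<integral>w. sin (inner \<zeta> w) \<partial>P n) = expectation (\<lambda>U. sin (inner \<zeta> (X (n + N) U)))"
          unfolding P_def using X[of "n + N"] by (subst integral_distr) auto
        then show ?thesis
          unfolding X_def by (simp only: expectation_sin_inner)
      qed
      moreover have "(\<integral>w. sin (inner \<zeta> w) \<partial>distr M borel z) = 0"
        by (subst integral_distr) (auto simp: std_complex_gaussian_cos_sin[OF assms(4)])
      ultimately show ?thesis by simp
    qed
  qed
  \<comment> \<open>The shift is undone for each test function separately.\<close>
  then show ?thesis
    unfolding weak_conv_bdd_cont_def P_def X_def by (blast intro: LIMSEQ_offset)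
qed

end
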